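(* Let $D$ be any orientation of a $7$-cycle (i.e.\ $D$ is isomorphic to one of $D_1,\dots,D_{10}$) and let $v\geq 7$ be an integer. There exists a $D$-decomposition of $K^*_v$ if and only if $v\equiv 0$ or $1 \pmod 7$.
   Context: $K^*_v$ denotes the complete symmetric digraph of order $v$: it has $v$ vertices and contains both arcs $(x,y)$ and $(y,x)$ for every pair of distinct vertices $x,y$. A $D$-decomposition of a digraph $K$ is a set of subdigraphs of $K$, each isomorphic to $D$, such that every arc of $K$ lies in exactly one of them. For distinct vertices $v_0,\dots,v_6$, the digraphs $D_i[v_0,v_1,\dots,v_6]$ ($i\in[1,10]$) all have vertex set $\{v_0,\dots,v_6\}$ and the following arc sets: $D_1$: $(v_1,v_0),(v_1,v_2),(v_2,v_3),(v_3,v_4),(v_4,v_5),(v_5,v_6),(v_6,v_0)$; $D_2$: $(v_1,v_0),(v_2,v_1),(v_2,v_3),(v_3,v_4),(v_4,v_5),(v_5,v_6),(v_6,v_0)$; $D_3$: $(v_1,v_0),(v_1,v_2),(v_3,v_2),(v_3,v_4),(v_4,v_5),(v_5,v_6),(v_6,v_0)$; $D_4$: $(v_1,v_0),(v_1,v_2),(v_2,v_3),(v_4,v_3),(v_4,v_5),(v_5,v_6),(v_6,v_0)$; $D_5$: $(v_1,v_0),(v_2,v_1),(v_3,v_2),(v_3,v_4),(v_4,v_5),(v_5,v_6),(v_6,v_0)$; $D_6$: $(v_1,v_0),(v_2,v_1),(v_2,v_3),(v_3,v_4),(v_5,v_4),(v_5,v_6),(v_6,v_0)$; $D_7$: $(v_1,v_0),(v_1,v_2),(v_3,v_2),(v_3,v_4),(v_4,v_5),(v_6,v_5),(v_6,v_0)$;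 $D_8$: $(v_1,v_0),(v_2,v_1),(v_2,v_3),(v_4,v_3),(v_4,v_5),(v_5,v_6),(v_6,v_0)$; $D_9$: $(v_1,v_0),(v_2,v_1),(v_2,v_3),(v_3,v_4),(v_4,v_5),(v_6,v_5),(v_6,v_0)$; $D_{10}$: $(v_0,v_1),(v_1,v_2),(v_2,v_3),(v_3,v_4),(v_4,v_5),(v_5,v_6),(v_6,v_0)$. $D_i$ also denotes the isomorphism type of $D_i[v_0,\dots,v_6]$; these ten digraphs are, up to isomorphism, all orientations of a $7$-cycle. *)

theory Defs
  imports Main
begin

(* A digraph on vertices of type 'a is given by its arc set; all digraphs considered
   here have no isolated vertices, so the arc set determines the digraph. *)

definition Kstar :: "nat \<Rightarrow> (nat \<times> nat) set" where
  "Kstar v = {(x, y). x < v \<and> y < v \<and> x \<noteq> y}"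

definition D_arcs :: "nat \<Rightarrow> (nat \<times> nat) set" where
  "D_arcs i =
    (if i = 1 then {(1,0),(1,2),(2,3),(3,4),(4,5),(5,6),(6,0)}
     else if i = 2 then {(1,0),(2,1),(2,3),(3,4),(4,5),(5,6),(6,0)}
     else if i = 3 then {(1,0),(1,2),(3,2),(3,4),(4,5),(5,6),(6,0)}
     else if i = 4 then {(1,0),(1,2),(2,3),(4,3),(4,5),(5,6),(6,0)}
     else if i = 5 then {(1,0),(2,1),(3,2),(3,4),(4,5),(5,6),(6,0)}
     else if i = 6 then {(1,0),(2,1),(2,3),(3,4),(5,4),(5,6),(6,0)}
     else if i = 7 then {(1,0),(1,2),(3,2),(3,4),(4,5),(6,5),(6,0)}
     else if i = 8 then {(1,0),(2,1),(2,3),(4,3),(4,5),(5,6),(6,0)}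
     else if i = 9 then {(1,0),(2,1),(2,3),(3,4),(4,5),(6,5),(6,0)}
     else {(0,1),(1,2),(2,3),(3,4),(4,5),(5,6),(6,0)})"

definition copy_of :: "(nat \<times> nat) set \<Rightarrow> nat \<Rightarrow> (nat \<times> nat) set \<Rightarrow> bool" where
  "copy_of D v H \<longleftrightarrow>
     (\<exists>f. inj_on f {0..6} \<and> f ` {0..6} \<subseteq> {0..<v} \<and>
          H = (\<lambda>(a, b). (f a, f b)) ` D)"

definition has_decomposition :: "(nat \<times> nat) set \<Rightarrow> nat \<Rightarrow> bool" where
  "has_decomposition D v \<longleftrightarrow>
     (\<exists>\<D>. (\<forall>H\<in>\<D>. copy_of D v H) \<and> (\<forall>e\<in>Kstar v. \<exists>!H. H \<in> \<D> \<and> e \<in> H))"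

end

theory Submission
  imports Defs
begin

text \<open>
  Counting arcs gives \<open>7 dvd v (v - 1)\<close>. Conversely, put \<open>v = 7 k + w\<close> with \<open>w \<le> 1\<close>. For \<open>k \<ge> 3\<close> take
  an idempotent Latin square of order \<open>k\<close>. Its off-diagonal cells \<open>(a, b)\<close> with entry \<open>c\<close> form triples
  in which every ordered pair of distinct elements appears exactly once in any two prescribed
  positions. A 7-cycle on \<open>{0, 1, 2} \<times> \<int>\<^sub>7\<close> whose seven arcs have pairwise different level differences,
  copied onto each triple and translated along \<open>\<int>\<^sub>7\<close>, then decomposes the complete multipartite
  digraph with \<open>k\<close> parts of size 7. The parts, extended by one common point if \<open>w = 1\<close>, are filled with
  decompositions on 7 or 8 points; the orders 7, 8, 14 and 15 are settled by explicit blocks.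
\<close>

section \<open>Decompositions of arc sets\<close>

definition complete_arcs :: "'a set \<Rightarrow> ('a \<times> 'a) set" where
  "complete_arcs V = {(x, y). x \<in> V \<and> y \<in> V \<and> x \<noteq> y}"

definition is_copy :: "(nat \<times> nat) set \<Rightarrow> ('a \<times> 'a) set \<Rightarrow> bool" where
  "is_copy D H \<longleftrightarrow> (\<exists>f. inj_on f {0..6} \<and> H = map_prod f f ` D)"

text \<open>The vertex type is arbitrary, so that points may be pairs of a part and a level. The
  condition \<open>H \<subseteq> E\<close> takes over the role of the range condition on
  \<open>f\<close> in \<open>copy_of\<close>.\<close>

definition decomposable :: "(nat \<times> nat) set \<Rightarrow> ('a \<times> 'a) set \<Rightarrow> bool" where
  "decomposable D E \<longleftrightarrow>
     (\<exists>\<F>. (\<forall>H\<in>\<F>. is_copy D H \<and> H \<subseteq> E) \<and> (\<forall>e\<in>E. \<exists>!H. H \<in> \<F> \<and> e \<in> H))"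

lemma is_copy_decomposable: "is_copy D H \<Longrightarrow> decomposable D H"
  unfolding decomposable_def by (rule exI[of _ "{H}"]) auto

lemma decomposable_UN:
  assumes dec: "\<And>i. i \<in> I \<Longrightarrow> decomposable D (E i)"
    and disj: "\<And>i j. i \<in> I \<Longrightarrow> j \<in> I \<Longrightarrow> i \<noteq> j \<Longrightarrow> E i \<inter> E j = {}"
  shows "decomposable D (\<Union>i\<in>I. E i)"
proof -
  have "\<forall>i\<in>I. \<exists>\<F>. (\<forall>H\<in>\<F>. is_copy D H \<and> H \<subseteq> E i) \<and> (\<forall>e\<in>E i. \<exists>!H. H \<in> \<F> \<and> e \<in> H)"
    using dec unfolding decomposable_def by blast
  then obtain F where F: "\<And>i. i \<in> I \<Longrightarrow> \<forall>H\<in>F i. is_copy D H \<and> H \<subseteq> E i"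
    "\<And>i. i \<in> I \<Longrightarrow> \<forall>e\<in>E i. \<exists>!H. H \<in> F i \<and> e \<in> H"
    by metis
  show ?thesis
    unfolding decomposable_def
  proof (intro exI[of _ "\<Union>i\<in>I. F i"] conjI ballI)
    fix e assume "e \<in> (\<Union>i\<in>I. E i)"
    then obtain i where i: "i \<in> I" "e \<in> E i" by blast
    then obtain H where H: "H \<in> F i" "e \<in> H" "\<And>H'. H' \<in> F i \<Longrightarrow> e \<in> H' \<Longrightarrow> H' = H"
      using F(2) by blast
    show "\<exists>!H. H \<in> (\<Union>i\<in>I. F i) \<and> e \<in> H"
    proof (rule ex1I[of _ H])
      fix H' assume "H' \<in> (\<Union>i\<in>I. F i) \<and> e \<in> H'"
      then obtain j where j: "j \<in> I" "H' \<in> F j" "e \<in> H'" by blast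
      then have "e \<in> E j" using F(1) by blast
      then have "j = i" using disj i j(1) by blast
      then show "H' = H" using H(3) j by blast
    qed (use H i in blast)
  qed (use F(1) in blast)+
qed

lemma decomposable_Un:
  assumes "decomposable D E" "decomposable D E'" "E \<inter> E' = {}"
  shows "decomposable D (E \<union> E')"
proof -
  have "decomposable D (\<Union>b\<in>UNIV. if b then E else E')"
    by (rule decomposable_UN) (use assms in \<open>auto split: if_splits\<close>)
  moreover have "(\<Union>b\<in>UNIV. if b then E else E') = E \<union> E'"
    by (auto split: if_splits)
  ultimately show ?thesis by simp
qed

text \<open>Every vertex of \<open>D\<close> lies on an arc, so confining the arcs of a copy
  confines all its vertices. This recovers the range condition of \<open>copy_of\<close> and lets a
  relabelling be injective on \<open>V\<close> only.\<close>

lemma copy_vertices_subset: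
  assumes "Field D = {0..6}" "map_prod f f ` D \<subseteq> V \<times> V"
  shows "f ` {0..6} \<subseteq> V"
proof
  fix y assume "y \<in> f ` {0..6}"
  then obtain a where a: "a \<in> Field D" "y = f a" using assms(1) by blast
  then obtain b where "(a, b) \<in> D \<or> (b, a) \<in> D" by (auto simp: Field_def)
  then have "map_prod f f (a, b) \<in> V \<times> V \<or> map_prod f f (b, a) \<in> V \<times> V"
    using assms(2) by blast
  then show "y \<in> V" using a by auto
qed

lemma decomposable_image:
  assumes D: "Field D = {0..6}" and g: "inj_on g V" and E: "E \<subseteq> V \<times> V"
    and dec: "decomposable D E"
  shows "decomposable D (map_prod g g ` E)"
proof -
  obtain \<F> where F: "\<forall>H\<in>\<F>. is_copy D H \<and> H \<subseteq> E"
    and F2: "\<forall>e\<in>E. \<exists>!H. H \<in> \<F> \<and> e \<in> H"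
    using dec unfolding decomposable_def by blast
  have F1: "is_copy D H" "H \<subseteq> E" if "H \<in> \<F>" for H
    using F that by auto
  have injE: "inj_on (map_prod g g) (V \<times> V)"
    using g by (rule map_prod_inj_on) (rule g)
  have copy: "is_copy D (map_prod g g ` H)" if "H \<in> \<F>" for H
  proof -
    obtain f where f: "inj_on f {0..6}" "H = map_prod f f ` D"
      using F1(1)[OF \<open>H \<in> \<F>\<close>] unfolding is_copy_def by blast
    have "f ` {0..6} \<subseteq> V"
      using F1(2)[OF \<open>H \<in> \<F>\<close>] E unfolding f(2) by (intro copy_vertices_subset[OF D]) simp
    then have "inj_on (g \<circ> f) {0..6}"
      using f(1) g by (meson comp_inj_on inj_on_subset)
    moreover have "map_prod g g ` H = map_prod (g \<circ> f) (g \<circ> f) ` D"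
      unfolding f(2) by (simp add: image_comp map_prod.comp)
    ultimately show ?thesis unfolding is_copy_def by blast
  qed
  show ?thesis
    unfolding decomposable_def
  proof (intro exI[of _ "image (map_prod g g) ` \<F>"] conjI ballI)
    fix e assume "e \<in> map_prod g g ` E"
    then obtain e0 where e0: "e0 \<in> E" "e = map_prod g g e0" by (rule imageE) simp
    \<comment> \<open>Uniqueness is transported through this equivalence: all copies live in
      \<open>V \<times> V\<close>, where the relabelling is injective on arcs.\<close>
    have iff: "e \<in> map_prod g g ` H \<longleftrightarrow> e0 \<in> H" if "H \<in> \<F>" for H
    proof -
      have "e0 \<in> V \<times> V" "H \<subseteq> V \<times> V" using F1(2)[OF that] E e0(1) by auto
      then show ?thesis unfolding e0(2) by (rule inj_on_image_mem_iff[OF injE])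
    qed
    obtain H where H: "H \<in> \<F>" "e0 \<in> H" "\<And>H'. H' \<in> \<F> \<Longrightarrow> e0 \<in> H' \<Longrightarrow> H' = H"
      using F2 e0(1) by blast
    show "\<exists>!H. H \<in> image (map_prod g g) ` \<F> \<and> e \<in> H"
    proof (rule ex1I[of _ "map_prod g g ` H"])
      show "map_prod g g ` H \<in> image (map_prod g g) ` \<F> \<and> e \<in> map_prod g g ` H"
        using H(1,2) iff by blast
      fix K assume "K \<in> image (map_prod g g) ` \<F> \<and> e \<in> K"
      then obtain H' where "H' \<in> \<F>" "K = map_prod g g ` H'" "e \<in> K" by blast
      then show "K = map_prod g g ` H" using H(3) iff by blast
    qed
  qed (use F1(2) copy in blast)+
qed

lemma map_prod_complete_arcs:
  assumes "inj_on g V"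
  shows "map_prod g g ` complete_arcs V = complete_arcs (g ` V)"
  using assms unfolding complete_arcs_def inj_on_def by force

text \<open>Relabelling along a bijection. It carries a small design onto each part of a larger
  point set, and the finished design on pairs back to an initial segment of the naturals.\<close>

lemma decomposable_complete_arcs_card:
  assumes "Field D = {0..6}" "decomposable D (complete_arcs A)"
    and "finite A" "finite B" "card A = card B"
  shows "decomposable D (complete_arcs B)"
proof -
  obtain g where g: "bij_betw g A B"
    using assms by (metis finite_same_card_bij)
  then have "inj_on g A" "g ` A = B" by (auto simp: bij_betw_def)
  then show ?thesis
    using decomposable_image[OF assms(1) \<open>inj_on g A\<close> _ assms(2)] map_prod_complete_arcs[of g A]
    by (auto simp: complete_arcs_def)
qed

section \<open>Passage to \<open>Kstar\<close> and the necessary divisibility condition\<close>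

lemma Kstar_eq_complete_arcs: "Kstar v = complete_arcs {..<v}"
  unfolding Kstar_def complete_arcs_def by auto

lemma decomposable_imp_has_decomposition:
  assumes D: "Field D = {0..6}" and dec: "decomposable D (complete_arcs {..<v})"
  shows "has_decomposition D v"
proof -
  obtain \<F> where F: "\<forall>H\<in>\<F>. is_copy D H \<and> H \<subseteq> Kstar v"
    "\<forall>e\<in>Kstar v. \<exists>!H. H \<in> \<F> \<and> e \<in> H"
    using dec unfolding decomposable_def Kstar_eq_complete_arcs by blast
  have "copy_of D v H" if "H \<in> \<F>" for H
  proof -
    have "is_copy D H" using F(1) that by blast
    then obtain f where f: "inj_on f {0..6}" "H = map_prod f f ` D"
      unfolding is_copy_def by blast
    have "f ` {0..6} \<subseteq> {0..<v}"
    proof (rule copy_vertices_subset[OF D])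
      have "H \<subseteq> Kstar v" using F(1) that by blast
      also have "\<dots> \<subseteq> {0..<v} \<times> {0..<v}" by (auto simp: Kstar_def)
      finally show "map_prod f f ` D \<subseteq> {0..<v} \<times> {0..<v}" unfolding f(2) .
    qed
    then show ?thesis
      unfolding copy_of_def using f unfolding map_prod_def by blast
  qed
  then show ?thesis unfolding has_decomposition_def using F(2) by blast
qed

lemma card_Kstar: "card (Kstar v) = v * (v - 1)"
proof -
  have "Kstar v = {..<v} \<times> {..<v} - (\<lambda>x. (x, x)) ` {..<v}"
    unfolding Kstar_def by auto
  moreover have "card ((\<lambda>x. (x, x)) ` {..<v}) = v"
    by (subst card_image) (auto simp: inj_on_def)
  ultimately show ?thesis
    by (simp add: card_Diff_subset image_subset_iff diff_mult_distrib2)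
qed

lemma finite_Kstar: "finite (Kstar v)"
  by (rule finite_subset[of _ "{..<v} \<times> {..<v}"]) (auto simp: Kstar_def)

text \<open>An injective image of a loopless digraph is loopless and has equally many arcs, so each
  copy lies inside \<open>Kstar v\<close>. The copies therefore partition the
  \<open>v * (v - 1)\<close> arcs into classes of size \<open>card D\<close>.\<close>

lemma has_decomposition_card_dvd:
  assumes D: "Field D \<subseteq> {0..6}" "irrefl D" and dec: "has_decomposition D v"
  shows "card D dvd v * (v - 1)"
proof -
  obtain \<F> where F: "\<And>H. H \<in> \<F> \<Longrightarrow> copy_of D v H"
    "\<forall>e\<in>Kstar v. \<exists>!H. H \<in> \<F> \<and> e \<in> H"
    using dec unfolding has_decomposition_def by blast
  have copy: "H \<subseteq> Kstar v \<and> card H = card D" if "H \<in> \<F>" for H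
  proof -
    obtain f where f: "inj_on f {0..6}" "f ` {0..6} \<subseteq> {0..<v}" "H = map_prod f f ` D"
      using F(1)[OF \<open>H \<in> \<F>\<close>] unfolding copy_of_def map_prod_def by blast
    have sub: "D \<subseteq> {0..6} \<times> {0..6}" using D(1) by (force simp: Field_def)
    have "inj_on (map_prod f f) D"
      by (rule inj_on_subset[OF map_prod_inj_on[OF f(1) f(1)] sub])
    moreover have "H \<subseteq> Kstar v"
    proof
      fix e assume "e \<in> H"
      then obtain a b where ab: "(a, b) \<in> D" "e = (f a, f b)" using f(3) by auto
      then have "a \<noteq> b" "a \<in> {0..6}" "b \<in> {0..6}"
        using sub D(2) by (auto simp: irrefl_def)
      then have "f a \<noteq> f b" "f a < v" "f b < v" using f(1,2) by (auto simp: inj_on_eq_iff image_subset_iff)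
      then show "e \<in> Kstar v" using ab by (simp add: Kstar_def)
    qed
    ultimately show ?thesis using f(3) by (simp add: card_image)
  qed
  have U: "\<Union>\<F> = Kstar v" using copy F(2) by blast
  have "card D * card \<F> = card (\<Union>\<F>)"
  proof (rule card_partition)
    show "finite \<F>" by (rule finite_UnionD) (simp add: U finite_Kstar)
    show "finite (\<Union>\<F>)" by (simp add: U finite_Kstar)
    show "card H = card D" if "H \<in> \<F>" for H using copy[OF that] by blast
    show "H \<inter> H' = {}" if "H \<in> \<F>" "H' \<in> \<F>" "H \<noteq> H'" for H H'
      using that F(2) U by blast
  qed
  then show ?thesis unfolding U card_Kstar by (metis dvd_triv_left)
qed

section \<open>Idempotent Latin squares\<close>

definition idem_latin :: "nat \<Rightarrow> (nat \<Rightarrow> nat \<Rightarrow> nat) \<Rightarrow> bool" where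
  "idem_latin n f \<longleftrightarrow> (\<forall>a<n. \<forall>b<n. f a b < n) \<and> (\<forall>a<n. f a a = a) \<and>
     (\<forall>a<n. inj_on (f a) {..<n}) \<and> (\<forall>b<n. inj_on (\<lambda>a. f a b) {..<n})"

text \<open>Together with the constant triples this is an orthogonal array of strength 2 and index
  1. Lists are used because a base block refers to the three positions by number.\<close>

definition latin_triples :: "nat \<Rightarrow> nat list set \<Rightarrow> bool" where
  "latin_triples n T \<longleftrightarrow>
     (\<forall>t\<in>T. length t = 3 \<and> distinct t \<and> set t \<subseteq> {..<n}) \<and>
     (\<forall>p<3. \<forall>q<3. \<forall>x<n. \<forall>y<n. p \<noteq> q \<longrightarrow> x \<noteq> y \<longrightarrow> (\<exists>!t. t \<in> T \<and> t ! p = x \<and> t ! q = y))"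

text \<open>Rows and columns are injective maps of a finite set into itself, hence permutations, so
  any two of row, column and entry determine the third. By idempotence the symbol \<open>a\<close>
  occurs in row \<open>a\<close> and in column \<open>a\<close> only on the diagonal; hence
  off-diagonal triples have distinct entries, and distinct prescribed values never lead to a
  diagonal cell.\<close>

lemma idem_latin_imp_latin_triples:
  assumes "idem_latin n f"
  shows "latin_triples n {[a, b, f a b] | a b. a < n \<and> b < n \<and> a \<noteq> b}" (is "latin_triples n ?T")
proof -
  have lt: "f a b < n" if "a < n" "b < n" for a b
    using assms that unfolding idem_latin_def by blast
  have idem: "f a a = a" if "a < n" for a
    using assms that unfolding idem_latin_def by blast
  have row: "f a b = f a b' \<longleftrightarrow> b = b'" if "a < n" "b < n" "b' < n" for a b b'
    using assms that unfolding idem_latin_def by (metis inj_onD lessThan_iff)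
  have col: "f a b = f a' b \<longleftrightarrow> a = a'" if "a < n" "a' < n" "b < n" for a a' b
    using inj_onD[of "\<lambda>a. f a b" "{..<n}" a a'] assms that unfolding idem_latin_def by auto
  have row_ex: "\<exists>b<n. f a b = c" if "a < n" "c < n" for a c
  proof -
    have "f a ` {..<n} = {..<n}"
      by (rule endo_inj_surj) (use that lt row in \<open>auto simp: inj_on_def\<close>)
    then show ?thesis using that by (metis imageE lessThan_iff)
  qed
  have col_ex: "\<exists>a<n. f a b = c" if "b < n" "c < n" for b c
  proof -
    have "(\<lambda>a. f a b) ` {..<n} = {..<n}"
      by (rule endo_inj_surj) (use that lt col in \<open>auto simp: inj_on_def\<close>)
    then show ?thesis using that by (metis (mono_tags, lifting) imageE lessThan_iff)
  qed
  have ne: "f a b \<noteq> a" "f a b \<noteq> b" if "a < n" "b < n" "a \<noteq> b" for a b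
    using row[of a b a] col[of a b b] idem that by auto
  have ex1: "\<exists>!t. t \<in> ?T \<and> t ! p = x \<and> t ! q = y"
    if "(p, q) \<in> {(0, 1), (0, 2), (1, 2)}" "x < n" "y < n" "x \<noteq> y" for p q x y
  proof -
    from that(1) consider "p = 0" "q = 1" | "p = 0" "q = 2" | "p = 1" "q = 2" by auto
    then show ?thesis
    proof cases
      case 1
      then show ?thesis using that by (intro ex1I[of _ "[x, y, f x y]"]) auto
    next
      case 2
      obtain b where b: "b < n" "f x b = y" using row_ex \<open>x < n\<close> \<open>y < n\<close> by blast
      then have "b \<noteq> x" using idem that by auto
      with 2 b that show ?thesis
        by (intro ex1I[of _ "[x, b, y]"]) (auto simp: row)
    next
      case 3
      obtain a where a: "a < n" "f a x = y" using col_ex \<open>x < n\<close> \<open>y < n\<close> by blast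
      then have "a \<noteq> x" using idem that by auto
      with 3 a that show ?thesis
        by (intro ex1I[of _ "[a, x, y]"]) (auto simp: col)
    qed
  qed
  have "\<exists>!t. t \<in> ?T \<and> t ! p = x \<and> t ! q = y"
    if "p < 3" "q < 3" "x < n" "y < n" "p \<noteq> q" "x \<noteq> y" for p q x y
  proof -
    have "(p, q) \<in> {(0, 1), (0, 2), (1, 2)} \<or> (q, p) \<in> {(0, 1), (0, 2), (1, 2)}"
      using that by auto
    then show ?thesis
    proof
      assume "(p, q) \<in> {(0, 1), (0, 2), (1, 2)}"
      from ex1[OF this that(3,4,6)] show ?thesis .
    next
      assume "(q, p) \<in> {(0, 1), (0, 2), (1, 2)}"
      from ex1[OF this that(4,3) that(6)[symmetric]] show ?thesis
        by (simp only: conj_commute)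
    qed
  qed
  moreover have "length t = 3 \<and> distinct t \<and> set t \<subseteq> {..<n}" if "t \<in> ?T" for t
    using that ne[symmetric] lt by auto
  ultimately show ?thesis unfolding latin_triples_def by simp
qed

section \<open>Squares of odd order and their prolongation to even order\<close>

definition odd_square :: "nat \<Rightarrow> nat \<Rightarrow> nat \<Rightarrow> nat" where
  "odd_square n a b = nat ((2 * int a - int b) mod int n)"

lemma int_mod_eq_less_imp_eq:
  fixes a b n :: nat
  assumes "int n dvd int a - int b" "a < n" "b < n"
  shows "a = b"
  using assms by (metis mod_eq_dvd_iff mod_less of_nat_eq_iff of_nat_mod)

lemma odd_square_eq_iff:
  assumes "n > 0"
  shows "odd_square n a b = odd_square n a' b' \<longleftrightarrow> int n dvd (2 * int a - int b) - (2 * int a' - int b')"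
  unfolding odd_square_def mod_eq_dvd_iff[symmetric] using assms
  by (simp add: eq_nat_nat_iff)

text \<open>The entry is 2a - b modulo n. Rows are injective because b has coefficient -1, columns
  because 2 is invertible modulo an odd n, and the diagonal gives 2a - a = a.\<close>

lemma idem_latin_odd_square:
  assumes "odd n"
  shows "idem_latin n (odd_square n)"
proof -
  have n: "n > 0" using assms by (simp add: odd_pos)
  have cop: "coprime (int n) 2" using assms by simp
  show ?thesis
    unfolding idem_latin_def
  proof (intro conjI allI impI inj_onI)
    fix a b assume "a < n" "b < n"
    then show "odd_square n a b < n" using n by (simp add: odd_square_def nat_less_iff)
  next
    fix a assume "a < n"
    then show "odd_square n a a = a" by (simp add: odd_square_def)
  next
    fix a b b' assume "a < n" and b: "b \<in> {..<n}" "b' \<in> {..<n}" and "odd_square n a b = odd_square n a b'"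
    then have "int n dvd int b' - int b" using n by (simp add: odd_square_eq_iff)
    then show "b = b'" using int_mod_eq_less_imp_eq[of n b' b] b by simp
  next
    fix b a a' assume "b < n" and a: "a \<in> {..<n}" "a' \<in> {..<n}" and "odd_square n a b = odd_square n a' b"
    then have "int n dvd 2 * (int a - int a')" using n by (simp add: odd_square_eq_iff algebra_simps)
    then have "int n dvd int a - int a'" using cop coprime_dvd_mult_right_iff by blast
    then show "a = a'" using int_mod_eq_less_imp_eq[of n a a'] a by simp
  qed
qed

text \<open>A transversal \<open>{(a, \<tau> a)}\<close> avoiding the diagonal is moved into a new row and column.\<close>

definition prolong :: "nat \<Rightarrow> (nat \<Rightarrow> nat) \<Rightarrow> (nat \<Rightarrow> nat) \<Rightarrow> (nat \<Rightarrow> nat \<Rightarrow> nat) \<Rightarrow> nat \<Rightarrow> nat \<Rightarrow> nat" where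
  "prolong n \<tau> \<sigma> f a b =
     (if a < n \<and> b < n then if b = \<tau> a then n else f a b
      else if a < n then f a (\<tau> a)
      else if b < n then f (\<sigma> b) b
      else n)"

text \<open>Each old row and column gives up its one transversal entry for the new symbol
  \<open>n\<close> and regains that entry in the new column or row. The new row and column are
  injective because the transversal entries are distinct; the diagonal survives because
  \<open>\<tau>\<close> has no fixed point.\<close>

lemma idem_latin_prolong:
  assumes f: "idem_latin n f"
    and tau: "\<And>a. a < n \<Longrightarrow> \<tau> a < n \<and> \<sigma> (\<tau> a) = a \<and> \<tau> a \<noteq> a"
    and sigma: "\<And>b. b < n \<Longrightarrow> \<sigma> b < n \<and> \<tau> (\<sigma> b) = b"
    and transversal: "inj_on (\<lambda>a. f a (\<tau> a)) {..<n}"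
  shows "idem_latin (Suc n) (prolong n \<tau> \<sigma> f)"
proof -
  have lt: "f a b < n" if "a < n" "b < n" for a b
    using f that unfolding idem_latin_def by blast
  have idem: "f a a = a" if "a < n" for a
    using f that unfolding idem_latin_def by blast
  have row: "f a b = f a b' \<longleftrightarrow> b = b'" if "a < n" "b < n" "b' < n" for a b b'
    using f that unfolding idem_latin_def by (metis inj_onD lessThan_iff)
  have col: "f a b = f a' b \<longleftrightarrow> a = a'" if "a < n" "a' < n" "b < n" for a a' b
    using inj_onD[of "\<lambda>a. f a b" "{..<n}" a a'] f that unfolding idem_latin_def by auto
  have tr: "f a (\<tau> a) = f a' (\<tau> a') \<longleftrightarrow> a = a'" if "a < n" "a' < n" for a a'
    using transversal that by (auto simp: inj_on_def)
  have tr': "f (\<sigma> b) b = f (\<sigma> b') b' \<longleftrightarrow> b = b'" if "b < n" "b' < n" for b b'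
    using tr[of "\<sigma> b" "\<sigma> b'"] that sigma by metis
  have lt_n: "f a b \<noteq> n" if "a < n" "b < n" for a b
    using lt[OF that] by simp
  show ?thesis
    unfolding idem_latin_def
  proof (intro conjI allI impI inj_onI)
    fix a b assume "a < Suc n" "b < Suc n"
    then show "prolong n \<tau> \<sigma> f a b < Suc n"
      using lt tau sigma by (auto simp: prolong_def less_Suc_eq)
  next
    fix a assume "a < Suc n"
    then show "prolong n \<tau> \<sigma> f a a = a"
      using idem tau by (force simp: prolong_def less_Suc_eq)
  next
    fix a b b' assume a: "a < Suc n" and b: "b \<in> {..<Suc n}" "b' \<in> {..<Suc n}"
      and eq: "prolong n \<tau> \<sigma> f a b = prolong n \<tau> \<sigma> f a b'"
    show "b = b'"
    proof (cases "a < n")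
      case True
      then have "\<tau> a < n" using tau by blast
      with True b eq lt_n[OF True] show ?thesis
        by (auto simp: prolong_def less_Suc_eq row split: if_splits)
    next
      case False
      with a b eq lt_n sigma show ?thesis
        by (auto simp: prolong_def less_Suc_eq tr' split: if_splits)
    qed
  next
    fix b a a' assume b: "b < Suc n" and a: "a \<in> {..<Suc n}" "a' \<in> {..<Suc n}"
      and eq: "prolong n \<tau> \<sigma> f a b = prolong n \<tau> \<sigma> f a' b"
    show "a = a'"
    proof (cases "b < n")
      case True
      then have s: "\<sigma> b < n" "\<tau> (\<sigma> b) = b" using sigma by auto
      \<comment> \<open>In column \<open>b\<close> the only cell overwritten by \<open>n\<close> is
        the one in row \<open>\<sigma> b\<close>.\<close>
      have t: "b = \<tau> x \<longleftrightarrow> x = \<sigma> b" if "x < n" for x using tau that s by metis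
      from True a eq s t lt[of a b] lt[of a' b] lt[of "\<sigma> b" b] show ?thesis
        by (auto simp: prolong_def less_Suc_eq col split: if_splits)
    next
      case False
      with a b eq tau lt[of a "\<tau> a"] lt[of a' "\<tau> a'"] show ?thesis
        by (auto simp: prolong_def less_Suc_eq tr split: if_splits)
    qed
  qed
qed

lemma exists_latin_triples:
  assumes "n \<ge> 3"
  shows "\<exists>T. latin_triples n T"
proof (cases "odd n")
  case True
  then show ?thesis using idem_latin_odd_square idem_latin_imp_latin_triples by blast
next
  case False
  define m where "m = n - 1"
  have m: "odd m" "m \<ge> 3" "n = Suc m"
    using False assms by (auto simp: m_def) presburger
  \<comment> \<open>The transversal is the cyclic superdiagonal b = a + 1 modulo \<open>m\<close>,
    whose entries 2a - (a + 1) = a - 1 are pairwise distinct; \<open>\<sigma>\<close> is the inverse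
    shift.\<close>
  define \<tau> where "\<tau> a = (if Suc a = m then 0 else Suc a)" for a
  define \<sigma> where "\<sigma> b = (if b = 0 then m - 1 else b - 1)" for b
  have inj: "inj_on (\<lambda>a. odd_square m a (\<tau> a)) {..<m}"
  proof (rule inj_onI)
    fix a a' assume a: "a \<in> {..<m}" "a' \<in> {..<m}"
      and "odd_square m a (\<tau> a) = odd_square m a' (\<tau> a')"
    then have d: "int m dvd (2 * int a - int (\<tau> a)) - (2 * int a' - int (\<tau> a'))"
      using m by (subst (asm) odd_square_eq_iff) auto
    have tau: "int m dvd int (\<tau> x) - int x - 1" for x
    proof (cases "Suc x = m")
      case True
      then have "int (\<tau> x) - int x - 1 = - int m" by (auto simp: \<tau>_def)
      then show ?thesis by simp
    qed (simp add: \<tau>_def)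
    \<comment> \<open>The added terms are multiples of \<open>m\<close> that replace
      \<open>\<tau> a\<close> by a + 1, which leaves just a - a'.\<close>
    have "int m dvd ((2 * int a - int (\<tau> a)) - (2 * int a' - int (\<tau> a')))
        + ((int (\<tau> a) - int a - 1) - (int (\<tau> a') - int a' - 1))"
      by (intro dvd_add dvd_diff d tau)
    then have "int m dvd int a - int a'" by (simp add: algebra_simps)
    then show "a = a'" using int_mod_eq_less_imp_eq[of m a a'] a by simp
  qed
  have "idem_latin (Suc m) (prolong m \<tau> \<sigma> (odd_square m))"
    by (rule idem_latin_prolong[OF idem_latin_odd_square[OF m(1)] _ _ inj])
      (use m in \<open>auto simp: \<tau>_def \<sigma>_def\<close>)
  then show ?thesis unfolding m(3) using idem_latin_imp_latin_triples by blast
qed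

section \<open>Explicit families of blocks\<close>

definition block_arcs :: "(nat \<times> nat) list \<Rightarrow> nat list \<Rightarrow> (nat \<times> nat) list" where
  "block_arcs L xs = map (\<lambda>(a, b). (xs ! a, xs ! b)) L"

text \<open>A form that can be checked by evaluation: if no arc repeats and the number of arcs is
  that of the complete digraph, then every arc is covered.\<close>

definition block_design :: "(nat \<times> nat) list \<Rightarrow> nat \<Rightarrow> nat list list \<Rightarrow> bool" where
  "block_design L v bs \<longleftrightarrow>
     list_all (\<lambda>xs. length xs = 7 \<and> distinct xs \<and> list_all (\<lambda>x. x < v) xs) bs \<and>
     distinct (concat (map (block_arcs L) bs)) \<and> length bs * length L = v * (v - 1)"

text \<open>Points below \<open>m\<close> form Z_m and are translated by the members of
  \<open>ts\<close>, which may be a proper subgroup. A point outside this range stays fixed and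
  serves as the point at infinity.\<close>

definition develop :: "nat \<Rightarrow> nat list \<Rightarrow> nat list list \<Rightarrow> nat list list" where
  "develop m ts bs =
     concat (map (\<lambda>t. map (map (\<lambda>x. if x < m then (x + t) mod m else x)) bs) ts)"

text \<open>This collects what the constructions use about an orientation of a 7-cycle: seven
  loopless arcs meeting all seven vertices.\<close>

definition spanning_arcs :: "(nat \<times> nat) list \<Rightarrow> bool" where
  "spanning_arcs L \<longleftrightarrow> length L = 7 \<and> distinct L \<and> list_all (\<lambda>(a, b). a < 7 \<and> b < 7 \<and> a \<noteq> b) L \<and>
     list_all (\<lambda>j. j \<in> set (map fst L @ map snd L)) [0..<7]"

lemma spanning_arcsD:
  assumes "spanning_arcs L"
  shows "card (set L) = 7" "Field (set L) = {0..6}" "irrefl (set L)"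
proof -
  show "card (set L) = 7"
    using assms by (auto simp: spanning_arcs_def distinct_card)
  have lt: "a < 7 \<and> b < 7 \<and> a \<noteq> b" if "(a, b) \<in> set L" for a b
    using assms that by (auto simp: spanning_arcs_def list_all_iff)
  then show "irrefl (set L)" by (auto simp: irrefl_def)
  have "Field (set L) = set (map fst L @ map snd L)"
    by (auto simp: Field_def Domain_fst Range_snd)
  moreover have "\<dots> \<subseteq> {..<7}" using lt by fastforce
  moreover have "{..<7} \<subseteq> set (map fst L @ map snd L)"
    using assms by (simp add: spanning_arcs_def list_all_iff lessThan_atLeast0 subset_iff)
  moreover have "{..<7 :: nat} = {0..6}" by auto
  ultimately show "Field (set L) = {0..6}" by (metis subset_antisym)
qed

lemma set_block_arcs: "set (block_arcs L xs) = map_prod ((!) xs) ((!) xs) ` set L"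
  by (simp add: block_arcs_def map_prod_def)

lemma Field_mem_le_6:
  assumes "Field D = {0..6 :: nat}" "(a, b) \<in> D"
  shows "a \<le> 6" "b \<le> 6"
  using FieldI1[OF assms(2)] FieldI2[OF assms(2)] assms(1) by auto

lemma block_design_decomposable:
  assumes L: "spanning_arcs L" and bs: "block_design L v bs"
  shows "decomposable (set L) (complete_arcs {..<v})"
proof -
  define H where "H i = set (block_arcs L (bs ! i))" for i
  have block: "length (bs ! i) = 7" "distinct (bs ! i)" "set (bs ! i) \<subseteq> {..<v}"
    if "i < length bs" for i
    using bs that by (auto simp: block_design_def list_all_iff)
  have dist: "distinct (concat (map (block_arcs L) bs))"
    using bs by (simp add: block_design_def)
  have F: "Field (set L) = {0..6}" and irr: "irrefl (set L)"
    using spanning_arcsD[OF L] by auto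
  have U: "(\<Union>i\<in>{..<length bs}. H i) = set (concat (map (block_arcs L) bs))"
  proof -
    have "set bs = (!) bs ` {..<length bs}" by (auto simp: set_conv_nth)
    then show ?thesis by (simp add: H_def)
  qed
  have sub: "H i \<subseteq> complete_arcs {..<v}" if i: "i < length bs" for i
  proof
    fix e assume "e \<in> H i"
    then obtain a b where ab: "(a, b) \<in> set L" "e = (bs ! i ! a, bs ! i ! b)"
      unfolding H_def set_block_arcs by auto
    have lt: "a < length (bs ! i)" "b < length (bs ! i)"
      using Field_mem_le_6[OF F ab(1)] block(1)[OF i] by auto
    have "a \<noteq> b" using irr ab(1) by (auto simp: irrefl_def)
    then show "e \<in> complete_arcs {..<v}"
      using block(2)[OF i] lt subsetD[OF block(3)[OF i] nth_mem[OF lt(1)]]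
        subsetD[OF block(3)[OF i] nth_mem[OF lt(2)]]
      by (auto simp: ab(2) complete_arcs_def nth_eq_iff_index_eq)
  qed
  have "decomposable (set L) (\<Union>i\<in>{..<length bs}. H i)"
  proof (rule decomposable_UN)
    fix i assume i: "i \<in> {..<length bs}"
    have "inj_on ((!) (bs ! i)) {0..6}"
      using block(1,2)[of i] i by (auto simp: inj_on_def nth_eq_iff_index_eq)
    then show "decomposable (set L) (H i)"
      unfolding H_def set_block_arcs by (intro is_copy_decomposable) (auto simp: is_copy_def)
  next
    fix i j assume "i \<in> {..<length bs}" "j \<in> {..<length bs}" "i \<noteq> j"
    then show "H i \<inter> H j = {}"
    proof (induction i j rule: linorder_wlog)
      case (le i j)
      \<comment> \<open>Cutting the list at position \<open>j\<close> leaves block \<open>i\<close>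
        in the prefix, so distinctness of the whole concatenation separates the two arc
        sets.\<close>
      then have "bs = take j bs @ bs ! j # drop (Suc j) bs" "bs ! i \<in> set (take j bs)"
        by (auto simp: id_take_nth_drop in_set_conv_nth intro!: exI[of _ i])
      then have "distinct (concat (map (block_arcs L) (take j bs)) @ block_arcs L (bs ! j)
          @ concat (map (block_arcs L) (drop (Suc j) bs)))"
        using dist by (metis concat.simps(2) concat_append list.simps(9) map_append)
      then show ?case using \<open>bs ! i \<in> _\<close> unfolding H_def by auto
    qed auto
  qed
  moreover have "(\<Union>i\<in>{..<length bs}. H i) = complete_arcs {..<v}"
  proof (rule card_subset_eq)
    show "finite (complete_arcs {..<v})"
      using finite_Kstar by (simp add: Kstar_eq_complete_arcs)
    show "(\<Union>i\<in>{..<length bs}. H i) \<subseteq> complete_arcs {..<v}" using sub by auto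
    have "length (concat (map (block_arcs L) bs)) = length bs * length L"
      by (induction bs) (auto simp: block_arcs_def)
    then show "card (\<Union>i\<in>{..<length bs}. H i) = card (complete_arcs {..<v})"
      unfolding U distinct_card[OF dist] Kstar_eq_complete_arcs[symmetric] card_Kstar
      using bs by (simp add: block_design_def)
  qed
  ultimately show ?thesis by simp
qed

section \<open>The complete multipartite digraph with parts of size 7\<close>

definition multipartite_arcs :: "nat \<Rightarrow> ((nat \<times> nat) \<times> (nat \<times> nat)) set" where
  "multipartite_arcs k = {((x, p), (y, q)). x < k \<and> y < k \<and> x \<noteq> y \<and> p < 7 \<and> q < 7}"

text \<open>A base block on the points \<open>{0, 1, 2} \<times> \<int>\<^sub>7\<close>, given by the lists of its first and second
  coordinates: every arc joins different parts and the arcs have pairwise different level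
  differences, so the translates of the block along \<open>\<int>\<^sub>7\<close> contain each level difference once.\<close>

definition levelled :: "(nat \<times> nat) list \<Rightarrow> nat list \<Rightarrow> nat list \<Rightarrow> bool" where
  "levelled L cs ls \<longleftrightarrow> length cs = 7 \<and> length ls = 7 \<and>
     list_all (\<lambda>c. c < 3) cs \<and> list_all (\<lambda>l. l < 7) ls \<and> distinct (zip cs ls) \<and>
     list_all (\<lambda>(a, b). cs ! a \<noteq> cs ! b) L \<and>
     distinct (map (\<lambda>(a, b). (ls ! b + 7 - ls ! a) mod 7) L)"

lemma mod_7_less_14:
  fixes x :: nat
  assumes "x < 14"
  shows "x mod 7 = (if x < 7 then x else x - 7)"
  using assms by (simp add: mod_if)

lemma add_mod_7_cancel:
  fixes a b s :: nat
  assumes "(a + s) mod 7 = (b + s) mod 7" "a < 7" "b < 7" "s < 7"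
  shows "a = b"
  using assms by (auto simp: mod_7_less_14 split: if_splits)

text \<open>Translations preserve differences and act regularly on Z_7, so the difference is a
  complete invariant of an ordered pair of levels. Adding 7 first keeps subtraction of naturals from
  truncating.\<close>

lemma shift_mod_7_iff:
  fixes a b p q :: nat
  assumes "a < 7" "b < 7" "p < 7" "q < 7"
  shows "(\<exists>s<7. (a + s) mod 7 = p \<and> (b + s) mod 7 = q) \<longleftrightarrow> (b + 7 - a) mod 7 = (q + 7 - p) mod 7"
proof
  assume "\<exists>s<7. (a + s) mod 7 = p \<and> (b + s) mod 7 = q"
  then obtain s where "s < 7" "(a + s) mod 7 = p" "(b + s) mod 7 = q" by blast
  then show "(b + 7 - a) mod 7 = (q + 7 - p) mod 7"
    using assms by (cases "a + s < 7"; cases "b + s < 7") (auto simp: mod_7_less_14)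
next
  assume d: "(b + 7 - a) mod 7 = (q + 7 - p) mod 7"
  define s where "s = (if a \<le> p then p - a else p + 7 - a)"
  have s: "s < 7" using assms by (auto simp: s_def)
  moreover have "(a + s) mod 7 = p"
    using assms s by (subst mod_7_less_14) (auto simp: s_def)
  moreover have "(b + s) mod 7 = q"
    using assms s d by (auto simp: s_def mod_7_less_14 split: if_splits)
  ultimately show "\<exists>s<7. (a + s) mod 7 = p \<and> (b + s) mod 7 = q" by blast
qed

text \<open>An arc from (x, p) to (y, q) can be traced back in exactly one way: the difference q - p
  selects the base arc, the level p then fixes the translation \<open>s\<close>, and x and y in the
  two positions named by \<open>cs\<close> fix the triple \<open>t\<close>.\<close>

lemma multipartite_decomposable:
  assumes L: "spanning_arcs L" and lev: "levelled L cs ls" and T: "latin_triples k T"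
  shows "decomposable (set L) (multipartite_arcs k)"
proof -
  have F: "Field (set L) = {0..6}"
    using L by (rule spanning_arcsD)
  have cs: "cs ! a < 3" and ls: "ls ! a < 7" if "a \<le> 6" for a
    using lev that by (auto simp: levelled_def list_all_iff)
  have cs_ne: "cs ! a \<noteq> cs ! b" if "(a, b) \<in> set L" for a b
    using lev that by (auto simp: levelled_def list_all_iff)
  have cl_inj: "a = b" if "a \<le> 6" "b \<le> 6" "cs ! a = cs ! b" "ls ! a = ls ! b" for a b
    using lev that nth_eq_iff_index_eq[of "zip cs ls" a b] by (auto simp: levelled_def)
  define \<delta> where "\<delta> e = (ls ! snd e + 7 - ls ! fst e) mod 7" for e
  have \<delta>_inj: "inj_on \<delta> (set L)"
    using lev by (auto simp: levelled_def \<delta>_def[abs_def] distinct_map case_prod_beta')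
  have "card (\<delta> ` set L) = 7"
    using spanning_arcsD(1)[OF L] by (simp add: card_image[OF \<delta>_inj])
  \<comment> \<open>Seven distinct residues exhaust Z_7, including 0, so arcs between equal levels
    are reached as well.\<close>
  then have \<delta>_surj: "\<delta> ` set L = {..<7}"
    by (intro card_subset_eq) (auto simp: \<delta>_def)
  have T1: "length t = 3" "distinct t" "set t \<subseteq> {..<k}" if "t \<in> T" for t
    using T that by (auto simp: latin_triples_def)
  have T2: "\<exists>!t. t \<in> T \<and> t ! p = x \<and> t ! q = y"
    if "p < 3" "q < 3" "x < k" "y < k" "p \<noteq> q" "x \<noteq> y" for p q x y
    using T that by (simp add: latin_triples_def)
  have T_eq: "t ! p = t ! q \<longleftrightarrow> p = q" if "t \<in> T" "p < 3" "q < 3" for t p q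
    using T1(1,2)[OF that(1)] that(2,3) by (simp add: nth_eq_iff_index_eq)
  have T_lt: "t ! p < k" if "t \<in> T" "p < 3" for t p
    using T1(1,3)[OF that(1)] that(2) by (metis lessThan_iff nth_mem subsetD)
  define f where "f t s j = (t ! (cs ! j), (ls ! j + s) mod 7)" for t :: "nat list" and s j
  define H where "H = (\<lambda>(t, s). map_prod (f t s) (f t s) ` set L)"
  have f_inj: "inj_on (f t s) {0..6}" if "t \<in> T" "s < 7" for t s
  proof (rule inj_onI)
    fix i j assume ij: "i \<in> {0..6}" "j \<in> {0..6}" "f t s i = f t s j"
    then have "cs ! i = cs ! j" using T_eq[OF that(1), of "cs ! i" "cs ! j"] cs by (auto simp: f_def)
    moreover have "ls ! i = ls ! j"
      using ij ls that(2) add_mod_7_cancel[of "ls ! i" s "ls ! j"] by (auto simp: f_def)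
    ultimately show "i = j" using cl_inj ij by auto
  qed
  have "decomposable (set L) (\<Union>ts\<in>T \<times> {..<7}. H ts)"
  proof (rule decomposable_UN)
    fix ts :: "nat list \<times> nat" assume "ts \<in> T \<times> {..<7}"
    then obtain t s where ts: "ts = (t, s)" "t \<in> T" "s < 7" by blast
    then have "is_copy (set L) (H ts)" using f_inj[OF ts(2,3)] by (auto simp: H_def is_copy_def)
    then show "decomposable (set L) (H ts)" by (rule is_copy_decomposable)
  next
    fix ts ts' :: "nat list \<times> nat"
    assume mem: "ts \<in> T \<times> {..<7}" "ts' \<in> T \<times> {..<7}" and ne: "ts \<noteq> ts'"
    obtain t s where ts: "ts = (t, s)" "t \<in> T" "s < 7" using mem(1) by blast
    obtain t' s' where ts': "ts' = (t', s')" "t' \<in> T" "s' < 7" using mem(2) by blast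
    show "H ts \<inter> H ts' = {}"
    proof (rule ccontr)
      assume "H ts \<inter> H ts' \<noteq> {}"
      then obtain e where "e \<in> H ts" "e \<in> H ts'" by blast
      then obtain a b a' b' where ab: "(a, b) \<in> set L" "(a', b') \<in> set L"
        and eq: "f t s a = f t' s' a'" "f t s b = f t' s' b'"
        by (force simp: H_def ts ts')
      have lev6: "a \<le> 6" "b \<le> 6" "a' \<le> 6" "b' \<le> 6"
        using Field_mem_le_6[OF F ab(1)] Field_mem_le_6[OF F ab(2)] by auto
      define p q where "p = (ls ! a + s) mod 7" and "q = (ls ! b + s) mod 7"
      have pq: "p < 7" "q < 7" "p = (ls ! a' + s') mod 7" "q = (ls ! b' + s') mod 7"
        using eq by (auto simp: p_def q_def f_def)
      have "\<delta> (a, b) = (q + 7 - p) mod 7"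
        using shift_mod_7_iff[of "ls ! a" "ls ! b" p q] ls lev6 ts(3) pq(1,2) p_def q_def
        by (auto simp: \<delta>_def)
      moreover have "\<delta> (a', b') = (q + 7 - p) mod 7"
        using shift_mod_7_iff[of "ls ! a'" "ls ! b'" p q] ls lev6 ts'(3) pq
        by (auto simp: \<delta>_def)
      ultimately have "(a, b) = (a', b')" using inj_onD[OF \<delta>_inj _ ab] by simp
      then have [simp]: "a' = a" "b' = b" by auto
      have "s = s'"
        using pq(3) ts(3) ts'(3) ls[OF lev6(1)] add_mod_7_cancel[of s "ls ! a" s'] by (simp add: p_def add.commute)
      moreover have "t = t'"
      proof -
        have "t ! (cs ! a) = t' ! (cs ! a)" "t ! (cs ! b) = t' ! (cs ! b)"
          using eq by (auto simp: f_def)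
        moreover have "t ! (cs ! a) \<noteq> t ! (cs ! b)"
          using T_eq[OF ts(2)] cs lev6 cs_ne[OF ab(1)] by auto
        ultimately show ?thesis
          using T2[of "cs ! a" "cs ! b" "t ! (cs ! a)" "t ! (cs ! b)"] T_lt[OF ts(2)]
            cs lev6 cs_ne[OF ab(1)] ts(2) ts'(2) by metis
      qed
      ultimately show False using ne ts ts' by simp
    qed
  qed
  moreover have "(\<Union>ts\<in>T \<times> {..<7}. H ts) = multipartite_arcs k"
  proof (intro subset_antisym subsetI)
    fix e assume "e \<in> (\<Union>ts\<in>T \<times> {..<7}. H ts)"
    then obtain t s a b where e: "t \<in> T" "(a, b) \<in> set L" "e = (f t s a, f t s b)"
      by (auto simp: H_def)
    then show "e \<in> multipartite_arcs k"
      using Field_mem_le_6[OF F e(2)] T_lt[OF e(1)] T_eq[OF e(1)] cs cs_ne[OF e(2)]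
      by (auto simp: multipartite_arcs_def f_def)
  next
    fix e assume "e \<in> multipartite_arcs k"
    then obtain x p y q where e: "e = ((x, p), (y, q))" "x < k" "y < k" "x \<noteq> y" "p < 7" "q < 7"
      by (auto simp: multipartite_arcs_def)
    have "(q + 7 - p) mod 7 \<in> \<delta> ` set L" unfolding \<delta>_surj by simp
    then obtain a b where ab: "(a, b) \<in> set L" "\<delta> (a, b) = (q + 7 - p) mod 7" by force
    note le = Field_mem_le_6[OF F ab(1)]
    obtain s where s: "s < 7" "(ls ! a + s) mod 7 = p" "(ls ! b + s) mod 7 = q"
      using shift_mod_7_iff[of "ls ! a" "ls ! b" p q] ls le e(5,6) ab(2) by (auto simp: \<delta>_def)
    obtain t where t: "t \<in> T" "t ! (cs ! a) = x" "t ! (cs ! b) = y"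
      using T2[of "cs ! a" "cs ! b" x y] cs le cs_ne[OF ab(1)] e by blast
    have "e = map_prod (f t s) (f t s) (a, b)" using s t by (simp add: e f_def)
    then have "e \<in> H (t, s)" using ab(1) unfolding H_def by auto
    then show "e \<in> (\<Union>ts\<in>T \<times> {..<7}. H ts)" using t(1) s(1) by blast
  qed
  ultimately show ?thesis by simp
qed

text \<open>Two different extended parts share at most the common point, hence no arc. An arc inside
  no extended part joins points of two different parts and so is multipartite.\<close>

lemma decomposable_fill_parts:
  assumes D: "Field D = {0..6}" and mult: "decomposable D (multipartite_arcs k)"
    and w: "w \<le> 1" and part: "decomposable D (complete_arcs {..<7 + w})"
  shows "decomposable D (complete_arcs {..<7 * k + w})"
proof -
  \<comment> \<open>The first coordinate \<open>k\<close> lies outside all parts, so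
    \<open>(k, 0)\<close> is a new point.\<close>
  define W where "W = (if w = 0 then {} else {(k, 0 :: nat)})"
  define G where "G g = {g} \<times> {..<7} \<union> W" for g :: nat
  define V where "V = {..<k} \<times> {..<7} \<union> W"
  have W: "finite W" "card W = w" using w by (auto simp: W_def)
  have disjG: "({g} \<times> {..<7}) \<inter> W = {}" if "g < k" for g using that by (auto simp: W_def)
  have disjV: "({..<k} \<times> {..<7}) \<inter> W = {}" by (auto simp: W_def)
  have G: "decomposable D (complete_arcs (G g))" if "g < k" for g
  proof (rule decomposable_complete_arcs_card[OF D part])
    show "card {..<7 + w} = card (G g)"
      unfolding G_def by (subst card_Un_disjoint) (use W disjG[OF that] in auto)
  qed (use W in \<open>auto simp: G_def\<close>)
  have "decomposable D ((\<Union>g\<in>{..<k}. complete_arcs (G g)) \<union> multipartite_arcs k)"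
  proof (intro decomposable_Un decomposable_UN mult)
    show "(\<Union>g\<in>{..<k}. complete_arcs (G g)) \<inter> multipartite_arcs k = {}"
      by (auto simp: complete_arcs_def multipartite_arcs_def G_def W_def split: if_splits)
    show "complete_arcs (G g) \<inter> complete_arcs (G g') = {}"
      if "g \<in> {..<k}" "g' \<in> {..<k}" "g \<noteq> g'" for g g'
      using that by (auto simp: complete_arcs_def G_def W_def split: if_splits)
  qed (use G in auto)
  also have "(\<Union>g\<in>{..<k}. complete_arcs (G g)) \<union> multipartite_arcs k = complete_arcs V"
    by (auto simp: complete_arcs_def multipartite_arcs_def G_def V_def W_def split: if_splits)
  finally have "decomposable D (complete_arcs V)" .
  then show ?thesis
  proof (rule decomposable_complete_arcs_card[OF D])
    show "card V = card {..<7 * k + w}"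
      unfolding V_def by (subst card_Un_disjoint) (use W disjV in auto)
  qed (use W in \<open>auto simp: V_def\<close>)
qed

section \<open>The equivalence from explicit data\<close>

definition ingredients ::
  "(nat \<times> nat) list \<Rightarrow> nat list list \<Rightarrow> nat list list \<Rightarrow> nat list list \<Rightarrow> nat list list \<Rightarrow>
   nat list \<Rightarrow> nat list \<Rightarrow> bool" where
  "ingredients L B7 B8 B14 B15 cs ls \<longleftrightarrow> spanning_arcs L \<and>
     block_design L 7 B7 \<and> block_design L 8 B8 \<and> block_design L 14 B14 \<and> block_design L 15 B15 \<and>
     levelled L cs ls"

lemma ingredients_iff_has_decomposition:
  assumes ing: "ingredients L B7 B8 B14 B15 cs ls" and v: "v \<ge> 7"
  shows "has_decomposition (set L) v \<longleftrightarrow> v mod 7 = 0 \<or> v mod 7 = 1"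
proof
  have L: "spanning_arcs L" using ing by (simp add: ingredients_def)
  have F: "Field (set L) = {0..6}" and "irrefl (set L)" and card: "card (set L) = 7"
    using spanning_arcsD[OF L] by auto
  {
    assume "has_decomposition (set L) v"
    then have "7 dvd v * (v - 1)"
      using has_decomposition_card_dvd[of "set L" v] F \<open>irrefl (set L)\<close> card by simp
    moreover obtain u where u: "v = Suc u" using v by (cases v) auto
    \<comment> \<open>With v = u + 1 the condition reads (u + 1) u = 0 modulo 7; running through the
      seven residues leaves only u = 0 and u = 6.\<close>
    ultimately have "(Suc (u mod 7) mod 7) * (u mod 7) mod 7 = 0"
      by (metis diff_Suc_1 dvd_imp_mod_0 mod_Suc_eq mod_mult_eq)
    moreover have "u mod 7 \<in> {0, 1, 2, 3, 4, 5, 6}"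
      using mod_less_divisor[of 7 u] by auto
    ultimately have "u mod 7 = 0 \<or> u mod 7 = 6" by (elim insertE) auto
    then show "v mod 7 = 0 \<or> v mod 7 = 1" unfolding u by (auto simp: mod_Suc)
  next
    assume r: "v mod 7 = 0 \<or> v mod 7 = 1"
    define k w where "k = v div 7" and "w = v mod 7"
    have kw: "v = 7 * k + w" "w = 0 \<or> w = 1" "k \<ge> 1" using v r by (auto simp: k_def w_def)
    have small: "decomposable (set L) (complete_arcs {..<u})" if "u \<in> {7, 8, 14, 15}" for u :: nat
      using that block_design_decomposable[OF L] ing by (auto simp: ingredients_def)
    have "decomposable (set L) (complete_arcs {..<v})"
    \<comment> \<open>No idempotent Latin square of order 2 exists, so two parts need explicit
      designs, on 14 and 15 points.\<close>
    proof (cases "k < 3")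
      case True
      then have "v \<in> {7, 8, 14, 15}" using kw by auto
      then show ?thesis by (rule small)
    next
      case False
      then obtain T where "latin_triples k T" using exists_latin_triples[of k] by auto
      then have "decomposable (set L) (multipartite_arcs k)"
        using multipartite_decomposable[OF L] ing by (auto simp: ingredients_def)
      moreover have "decomposable (set L) (complete_arcs {..<7 + w})"
        by (rule small) (use kw(2) in auto)
      ultimately show ?thesis
        unfolding kw(1) using decomposable_fill_parts[OF F] kw(2) by auto
    qed
    then show "has_decomposition (set L) v" by (rule decomposable_imp_has_decomposition[OF F])
  }
qed

section \<open>Base blocks for the ten orientations\<close>

lemmas ingredients_simps = ingredients_def spanning_arcs_def block_design_def develop_def block_arcs_def
  levelled_def upt_conv_Cons

text \<open>For this and the next eight orientations the designs are cyclic: one base block over Z_6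
  with a fixed point, one over Z_8, two over Z_13 with a fixed point, two over Z_15. For the
  directed cycle a single block over Z_8 is impossible, since its differences sum to 0 while 1, ...,
  7 sum to 4 modulo 8; \<open>ingredients_D10\<close> therefore takes two blocks under the even
  translations.\<close>

lemma ingredients_D1:
  "ingredients [(1, 0), (1, 2), (2, 3), (3, 4), (4, 5), (5, 6), (6, 0)]
     (develop 6 [0..<6] [[1, 3, 4, 0, 5, 2, 6]])
     (develop 8 [0..<8] [[0, 2, 3, 6, 5, 7, 4]])
     (develop 13 [0..<13] [[0, 8, 11, 5, 13, 6, 12], [9, 7, 6, 4, 12, 8, 5]])
     (develop 15 [0..<15] [[14, 6, 11, 10, 13, 2, 3], [9, 2, 11, 13, 4, 1, 14]])
     [0, 1, 0, 1, 0, 1, 2] [0, 0, 1, 3, 2, 5, 2]"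
  by (simp add: ingredients_simps)

lemma ingredients_D2:
  "ingredients [(1, 0), (2, 1), (2, 3), (3, 4), (4, 5), (5, 6), (6, 0)]
     (develop 6 [0..<6] [[0, 2, 1, 4, 3, 5, 6]])
     (develop 8 [0..<8] [[4, 3, 6, 0, 7, 5, 1]])
     (develop 13 [0..<13] [[5, 7, 12, 11, 2, 3, 0], [6, 3, 1, 13, 10, 4, 0]])
     (develop 15 [0..<15] [[3, 11, 10, 4, 9, 6, 8], [12, 13, 5, 8, 14, 3, 1]])
     [0, 1, 2, 0, 1, 0, 1] [0, 1, 0, 2, 0, 3, 3]"
  by (simp add: ingredients_simps)

lemma ingredients_D3:
  "ingredients [(1, 0), (1, 2), (3, 2), (3, 4), (4, 5), (5, 6), (6, 0)]
     (develop 6 [0..<6] [[1, 5, 0, 3, 6, 4, 2]])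
     (develop 8 [0..<8] [[3, 5, 2, 6, 7, 1, 0]])
     (develop 13 [0..<13] [[1, 5, 2, 4, 6, 7, 11], [12, 5, 11, 3, 13, 8, 0]])
     (develop 15 [0..<15] [[8, 4, 0, 12, 6, 5, 7], [9, 11, 8, 13, 4, 12, 2]])
     [0, 1, 0, 1, 0, 1, 2] [0, 1, 1, 0, 2, 5, 2]"
  by (simp add: ingredients_simps)

lemma ingredients_D4:
  "ingredients [(1, 0), (1, 2), (2, 3), (4, 3), (4, 5), (5, 6), (6, 0)]
     (develop 6 [0..<6] [[1, 4, 6, 5, 0, 2, 3]])
     (develop 8 [0..<8] [[0, 1, 3, 7, 4, 5, 2]])
     (develop 13 [0..<13] [[0, 11, 12, 6, 1, 7, 4], [1, 11, 9, 4, 5, 13, 10]])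
     (develop 15 [0..<15] [[5, 0, 2, 10, 4, 8, 9], [13, 1, 4, 14, 7, 6, 0]])
     [0, 1, 0, 1, 0, 1, 2] [0, 1, 1, 3, 2, 0, 3]"
  by (simp add: ingredients_simps)

lemma ingredients_D5:
  "ingredients [(1, 0), (2, 1), (3, 2), (3, 4), (4, 5), (5, 6), (6, 0)]
     (develop 6 [0..<6] [[5, 0, 2, 1, 4, 6, 3]])
     (develop 8 [0..<8] [[2, 5, 3, 4, 0, 6, 1]])
     (develop 13 [0..<13] [[7, 4, 6, 12, 8, 9, 2], [9, 13, 7, 3, 11, 0, 12]])
     (develop 15 [0..<15] [[5, 13, 8, 6, 4, 10, 11], [11, 0, 3, 10, 14, 9, 8]])
     [0, 1, 0, 1, 0, 1, 2] [0, 1, 1, 0, 2, 5, 2]"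
  by (simp add: ingredients_simps)

lemma ingredients_D6:
  "ingredients [(1, 0), (2, 1), (2, 3), (3, 4), (5, 4), (5, 6), (6, 0)]
     (develop 6 [0..<6] [[2, 6, 5, 3, 4, 1, 0]])
     (develop 8 [0..<8] [[2, 1, 3, 7, 4, 5, 0]])
     (develop 13 [0..<13] [[11, 6, 12, 10, 5, 8, 9], [0, 9, 10, 13, 7, 1, 4]])
     (develop 15 [0..<15] [[11, 13, 3, 8, 1, 4, 10], [11, 7, 8, 10, 4, 12, 0]])
     [0, 1, 0, 1, 0, 1, 2] [0, 0, 1, 3, 6, 5, 2]"
  by (simp add: ingredients_simps)

lemma ingredients_D7:
  "ingredients [(1, 0), (1, 2), (3, 2), (3, 4), (4, 5), (6, 5), (6, 0)]
     (develop 6 [0..<6] [[5, 3, 4, 0, 6, 1, 2]])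
     (develop 8 [0..<8] [[3, 5, 0, 1, 2, 4, 7]])
     (develop 13 [0..<13] [[6, 5, 4, 1, 9, 0, 8], [11, 9, 2, 8, 13, 10, 1]])
     (develop 15 [0..<15] [[4, 10, 9, 7, 8, 6, 11], [13, 2, 6, 0, 3, 8, 1]])
     [0, 1, 0, 1, 0, 1, 2] [0, 0, 1, 3, 2, 5, 3]"
  by (simp add: ingredients_simps)

lemma ingredients_D8:
  "ingredients [(1, 0), (2, 1), (2, 3), (4, 3), (4, 5), (5, 6), (6, 0)]
     (develop 6 [0..<6] [[0, 1, 3, 4, 2, 5, 6]])
     (develop 8 [0..<8] [[0, 5, 4, 3, 1, 6, 2]])
     (develop 13 [0..<13] [[7, 13, 6, 0, 2, 11, 12], [1, 2, 9, 0, 10, 7, 12]])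
     (develop 15 [0..<15] [[11, 4, 7, 12, 14, 2, 3], [0, 1, 6, 2, 13, 7, 9]])
     [0, 1, 0, 1, 0, 1, 2] [0, 0, 1, 3, 2, 5, 2]"
  by (simp add: ingredients_simps)

lemma ingredients_D9:
  "ingredients [(1, 0), (2, 1), (2, 3), (3, 4), (4, 5), (6, 5), (6, 0)]
     (develop 6 [0..<6] [[1, 0, 4, 6, 5, 2, 3]])
     (develop 8 [0..<8] [[6, 5, 2, 0, 7, 3, 1]])
     (develop 13 [0..<13] [[8, 9, 1, 2, 13, 10, 3], [3, 6, 4, 0, 11, 1, 10]])
     (develop 15 [0..<15] [[3, 0, 1, 14, 11, 6, 2], [9, 13, 5, 7, 14, 8, 3]])
     [0, 1, 0, 1, 0, 1, 2] [0, 0, 1, 3, 6, 4, 3]"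
  by (simp add: ingredients_simps)

text \<open>The family for \<open>D\<^sub>1\<^sub>0\<close> on 14 points cannot consist of two base blocks over \<open>\<int>\<^sub>1\<^sub>3 \<union> {\<infinity>}\<close>: all
  nonzero differences and those of the block avoiding \<open>\<infinity>\<close> sum to 0, hence so would the five
  differences along the path left by the other block. Instead it has three full orbits under the
  even translations of \<open>\<int>\<^sub>1\<^sub>4\<close> and five cycles invariant under them.\<close>

lemma ingredients_D10:
  "ingredients [(0, 1), (1, 2), (2, 3), (3, 4), (4, 5), (5, 6), (6, 0)]
     (develop 6 [0..<6] [[6, 0, 5, 1, 4, 2, 3]])
     (develop 8 [0, 2, 4, 6] [[0, 3, 4, 2, 6, 7, 5], [3, 0, 7, 1, 5, 4, 6]])
     (develop 14 [0, 2, 4, 6, 8, 10, 12]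
      [[10, 11, 3, 6, 13, 4, 12], [4, 9, 2, 5, 1, 13, 0], [12, 7, 4, 1, 5, 0, 13]] @
      [[0, 10, 6, 2, 12, 8, 4], [1, 9, 3, 11, 5, 13, 7], [1, 3, 5, 7, 9, 11, 13],
       [0, 2, 4, 6, 8, 10, 12], [0, 6, 12, 4, 10, 2, 8]])
     (develop 15 [0..<15] [[13, 3, 5, 0, 1, 4, 2], [4, 10, 14, 8, 7, 0, 12]])
     [0, 1, 0, 1, 0, 1, 2] [0, 0, 1, 3, 2, 5, 2]"
  by (simp add: ingredients_simps)

theorem theorem3p7:
  fixes i v :: nat
  assumes "i \<in> {1..10}" and "v \<ge> 7"
  shows "has_decomposition (D_arcs i) v \<longleftrightarrow> (v mod 7 = 0 \<or> v mod 7 = 1)"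
proof -
  from assms(1) have "i \<in> {1, 2, 3, 4, 5, 6, 7, 8, 9, 10}" by simp arith
  then show ?thesis
    using ingredients_iff_has_decomposition[OF ingredients_D1 assms(2)]
      ingredients_iff_has_decomposition[OF ingredients_D2 assms(2)]
      ingredients_iff_has_decomposition[OF ingredients_D3 assms(2)]
      ingredients_iff_has_decomposition[OF ingredients_D4 assms(2)]
      ingredients_iff_has_decomposition[OF ingredients_D5 assms(2)]
      ingredients_iff_has_decomposition[OF ingredients_D6 assms(2)]
      ingredients_iff_has_decomposition[OF ingredients_D7 assms(2)]
      ingredients_iff_has_decomposition[OF ingredients_D8 assms(2)]
      ingredients_iff_has_decomposition[OF ingredients_D9 assms(2)]
      ingredients_iff_has_decomposition[OF ingredients_D10 assms(2)]
    by (elim insertE) (simp_all add: D_arcs_def)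
qed

end
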